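(* Assume $\mathfrak{u}<\mathfrak{g}$. Then no (non-principal) ultrafilter on $\omega$ is a Michael ultrafilter.
   Context: All ultrafilters are non-principal ultrafilters on $\omega$. For an ultrafilter $\mathscr{U}$ and $f,g\in\omega^\omega$, $f\leq_{\mathscr{U}} g$ means $\{n\in\omega : f(n)\leq g(n)\}\in\mathscr{U}$. For $K\subseteq\omega^\omega$, $\mathrm{cof}(K/\mathscr{U})$ is the least cardinality of a set $D\subseteq K$ such that for every $f\in K$ there is $g\in D$ with $f\leq_{\mathscr{U}} g$. $\mathscr{U}$ is a Michael ultrafilter if for every compact $K\subseteq\omega^\omega$, if $\mathrm{cof}(K/\mathscr{U})>\omega$ then $\mathrm{cof}(K/\mathscr{U})\geq\mathrm{cof}(\omega^\omega/\mathscr{U})$. The character $\chi(\mathscr{U})$ is the least cardinality of a basis of $\mathscr{U}$, i.e. of a $B\subseteq\mathscr{U}$ such that every $U\in\mathscr{U}$ contains some $V\in B$. $\mathfrak{u}$ is the least value of $\chi(\mathscr{U})$ over all ultrafilters $\mathscr{U}$. A set $G\subseteq[\omega]^\omega$ (infinite subsets of $\omega$) is groupwise dense if $G$ is closed under infinite subsets and finite modifications, and for every partition $\langle I_n : n\in\omega\rangle$ of $\omega$ into finite intervals there is an infinite $A\subseteq\omega$ such that $\bigcup_{n\in A} I_n\in G$. $\mathfrak{g}$ is the least cardinality of a collection of groupwise dense sets with empty intersection. *)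

theory Defs
  imports "HOL-Analysis.Analysis"
begin

unbundle cardinal_syntax

text \<open>
  Cardinals are cardinal orders \<open>'a rel\<close> up to \<open>=o\<close>. The choice in \<open>least_card\<close> is only
  determined up to \<open>=o\<close>, which suffices because its values are only compared by
  \<open>\<le>o\<close> and \<open><o\<close>.
\<close>

definition least_card :: "'a rel set \<Rightarrow> 'a rel" where
  "least_card R = (SOME r. r \<in> R \<and> (\<forall>r'\<in>R. r \<le>o r'))"

lemma least_card:
  assumes "R \<noteq> {}" and "\<forall>r\<in>R. Card_order r"
  shows "least_card R \<in> R" and "\<And>r. r \<in> R \<Longrightarrow> least_card R \<le>o r"
proof -
  have "\<exists>r. r \<in> R \<and> (\<forall>r'\<in>R. r \<le>o r')"
    using exists_minim_Card_order[OF assms] by blast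
  from someI_ex[OF this] show "least_card R \<in> R" and "\<And>r. r \<in> R \<Longrightarrow> least_card R \<le>o r"
    unfolding least_card_def by blast+
qed

text \<open>
  An ultrafilter on \<open>\<omega>\<close> is given as an element \<open>U\<close> of the type \<open>nat filter\<close>; its members are
  the sets \<open>A\<close> with \<open>eventually (\<lambda>n. n \<in> A) U\<close>. The type also contains the improper
  filter \<open>bot\<close>.
\<close>

definition nonprincipal_ultrafilter :: "nat filter \<Rightarrow> bool" where
  "nonprincipal_ultrafilter U \<longleftrightarrow>
     U \<noteq> bot \<and>
     (\<forall>A. eventually (\<lambda>n. n \<in> A) U \<or> eventually (\<lambda>n. n \<notin> A) U) \<and>
     (\<forall>n. U \<noteq> principal {n})"

definition le_mod :: "nat filter \<Rightarrow> (nat \<Rightarrow> nat) \<Rightarrow> (nat \<Rightarrow> nat) \<Rightarrow> bool" where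
  "le_mod U f g \<longleftrightarrow> eventually (\<lambda>n. f n \<le> g n) U"

definition cof_mod :: "(nat \<Rightarrow> nat) set \<Rightarrow> nat filter \<Rightarrow> (nat \<Rightarrow> nat) rel" where
  "cof_mod K U = least_card {|D| | D. D \<subseteq> K \<and> (\<forall>f\<in>K. \<exists>g\<in>D. le_mod U f g)}"

text \<open>
  Here \<open>compact\<close> refers to the product topology on \<open>nat \<Rightarrow> nat\<close>, with \<open>nat\<close> discrete.
\<close>

definition Michael_ultrafilter :: "nat filter \<Rightarrow> bool" where
  "Michael_ultrafilter U \<longleftrightarrow>
     nonprincipal_ultrafilter U \<and>
     (\<forall>K :: (nat \<Rightarrow> nat) set. compact K \<longrightarrow>
        natLeq <o cof_mod K U \<longrightarrow> cof_mod UNIV U \<le>o cof_mod K U)"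

definition filter_basis :: "nat filter \<Rightarrow> nat set set \<Rightarrow> bool" where
  "filter_basis U B \<longleftrightarrow>
     B \<subseteq> {A. eventually (\<lambda>n. n \<in> A) U} \<and>
     (\<forall>A. eventually (\<lambda>n. n \<in> A) U \<longrightarrow> (\<exists>V\<in>B. V \<subseteq> A))"

definition character :: "nat filter \<Rightarrow> nat set rel" where
  "character U = least_card {|B| | B. filter_basis U B}"

definition cardinal_u :: "nat set rel" where
  "cardinal_u = least_card {character U | U. nonprincipal_ultrafilter U}"

definition interval_partition :: "(nat \<Rightarrow> nat set) \<Rightarrow> bool" where
  "interval_partition I \<longleftrightarrow>
     (\<forall>n. \<exists>a b. a < b \<and> I n = {a..<b}) \<and> disjoint_family I \<and> (\<Union>n. I n) = UNIV"

definition groupwise_dense :: "nat set set \<Rightarrow> bool" where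
  "groupwise_dense G \<longleftrightarrow>
     (\<forall>X\<in>G. infinite X) \<and>
     (\<forall>X\<in>G. \<forall>Y. Y \<subseteq> X \<longrightarrow> infinite Y \<longrightarrow> Y \<in> G) \<and>
     (\<forall>X\<in>G. \<forall>Y. finite (sym_diff X Y) \<longrightarrow> Y \<in> G) \<and>
     (\<forall>I. interval_partition I \<longrightarrow> (\<exists>A. infinite A \<and> (\<Union>n\<in>A. I n) \<in> G))"

definition cardinal_g :: "nat set set rel" where
  "cardinal_g = least_card {|C| | C. (\<forall>G\<in>C. groupwise_dense G) \<and> \<Inter>C = {}}"

end

theory Submission
  imports Defs "HOL-Library.Countable_Set_Type"
begin

text \<open>
  Let \<open>U\<close> be any non-principal ultrafilter and assume \<open>\<uu> < \<gg>\<close>. The proof finds a compact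
  set whose cofinality modulo \<open>U\<close> is uncountable and at most \<open>\<uu>\<close>, whereas the cofinality of
  \<open>\<omega>\<^sup>\<omega>\<close> modulo \<open>U\<close> exceeds \<open>\<uu>\<close>.

  Groupwise density enters twice, each time by intersecting fewer than \<open>\<gg>\<close> groupwise dense
  sets, one for each function or basis set. First, fewer than \<open>\<gg>\<close> functions are never cofinal
  modulo an ultrafilter (\<open>fewer_than_g_not_cofinal\<close>): a set with long gaps yields a
  next-element function that none of them dominates. Second, \<open>U\<close> is nearly coherent with an
  ultrafilter \<open>W\<close> of character \<open>\<uu>\<close>: some set \<open>X\<close> cuts \<open>\<omega>\<close> into intervals such that collapsing
  each of them to a point sends \<open>U\<close> and \<open>W\<close> to the same ultrafilter \<open>V\<close>. Hence a finite-to-one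
  image \<open>V\<close> of \<open>U\<close> has a basis of size at most \<open>\<uu>\<close> (\<open>finite_to_one_image_small_character\<close>).
  A compact set of functions with given cofinality modulo \<open>V\<close> can be pulled back to one with
  the same cofinality modulo \<open>U\<close>, so it is enough to treat \<open>V\<close>.

  For \<open>X \<subseteq> \<omega>\<close>, let \<open>g\<^sub>X n\<close> be the next element of \<open>X\<close> after \<open>n\<close>, truncated near a bound \<open>h n\<close>, if
  \<open>n \<in> X\<close>, and let \<open>g\<^sub>X n = 0\<close> otherwise. Truncation makes \<open>X \<mapsto> g\<^sub>X\<close> continuous, so the
  \<open>g\<^sub>X\<close> form a compact set. If \<open>X \<notin> V\<close>, then \<open>g\<^sub>X\<close> vanishes modulo \<open>V\<close>; if \<open>X \<in> V\<close>, then \<open>g\<^sub>X\<close> only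
  grows modulo \<open>V\<close> when \<open>X\<close> shrinks. So the functions \<open>g\<^sub>B\<close>, for \<open>B\<close> in a basis of \<open>V\<close>, are
  cofinal. Countably many do not suffice: \<open>V\<close> is a P-point because its character is small
  (\<open>P_point_of_small_character\<close>), so countably many sets in \<open>V\<close> have a pseudo-intersection in
  \<open>V\<close>, and passing to half of it, no two consecutive elements being kept, increases the next
  element once more. For this the truncation must be invisible modulo \<open>V\<close>; a suitable \<open>h\<close> exists
  because the next-element functions of the basis sets are not cofinal.
\<close>

section \<open>Non-principal ultrafilters and cofinal families\<close>

lemma ultrafilter_eventually_not:
  assumes "nonprincipal_ultrafilter U"
  shows "eventually (\<lambda>n. \<not> P n) U \<longleftrightarrow> \<not> eventually P U"
proof
  assume "eventually (\<lambda>n. \<not> P n) U"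
  moreover have "U \<noteq> bot"
    using assms by (simp add: nonprincipal_ultrafilter_def)
  ultimately show "\<not> eventually P U"
    using eventually_happens'[of U "\<lambda>n. \<not> P n \<and> P n"] eventually_conj by blast
next
  have "eventually (\<lambda>n. n \<in> Collect P) U \<or> eventually (\<lambda>n. n \<notin> Collect P) U"
    using assms unfolding nonprincipal_ultrafilter_def by blast
  then show "\<not> eventually P U \<Longrightarrow> eventually (\<lambda>n. \<not> P n) U"
    by simp
qed

lemma ultrafilter_eventually_happens:
  assumes "nonprincipal_ultrafilter U" "eventually P U"
  shows "\<exists>n. P n"
  using assms eventually_happens'[of U P] by (auto simp: nonprincipal_ultrafilter_def)

text \<open>
  An ultrafilter that contains \<open>{k}\<close> consists of exactly the sets containing \<open>k\<close>.
\<close>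

lemma ultrafilter_eventually_neq:
  assumes "nonprincipal_ultrafilter U"
  shows "eventually (\<lambda>n. n \<noteq> k) U"
proof (rule ccontr)
  assume "\<not> eventually (\<lambda>n. n \<noteq> k) U"
  then have k: "eventually (\<lambda>n. n = k) U"
    using ultrafilter_eventually_not[OF assms] by blast
  have "eventually P U \<longleftrightarrow> P k" for P
  proof
    assume "eventually P U"
    with k have "eventually (\<lambda>n. P n \<and> n = k) U" by eventually_elim simp
    then show "P k" using ultrafilter_eventually_happens[OF assms] by blast
  next
    assume "P k"
    with k show "eventually P U" by (auto elim: eventually_mono)
  qed
  then have "U = principal {k}"
    by (simp add: filter_eq_iff eventually_principal)
  then show False
    using assms by (simp add: nonprincipal_ultrafilter_def)
qed

lemma ultrafilter_finite:
  assumes "nonprincipal_ultrafilter U" "finite S"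
  shows "eventually (\<lambda>n. n \<notin> S) U"
proof -
  have "eventually (\<lambda>n. \<forall>k\<in>S. n \<noteq> k) U"
    using assms ultrafilter_eventually_neq by (simp add: eventually_ball_finite)
  then show ?thesis by (auto elim!: eventually_mono)
qed

lemma ultrafilter_ge:
  assumes "nonprincipal_ultrafilter U"
  shows "eventually (\<lambda>n. m \<le> n) U"
  using ultrafilter_finite[OF assms, of "{..<m}"] by (auto elim!: eventually_mono)

lemma ultrafilter_infinite:
  assumes "nonprincipal_ultrafilter U" "eventually (\<lambda>n. n \<in> X) U"
  shows "infinite X"
  using ultrafilter_finite[OF assms(1)] ultrafilter_eventually_not[OF assms(1)] assms(2) by blast

lemma nonprincipal_ultrafilter_filtermap:
  assumes U: "nonprincipal_ultrafilter U" and fin: "\<And>k. finite (f -` {k})"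
  shows "nonprincipal_ultrafilter (filtermap f U)"
  unfolding nonprincipal_ultrafilter_def
proof (intro conjI allI)
  show "filtermap f U \<noteq> bot"
    using U by (simp add: nonprincipal_ultrafilter_def filtermap_bot_iff)
  show "eventually (\<lambda>n. n \<in> A) (filtermap f U) \<or> eventually (\<lambda>n. n \<notin> A) (filtermap f U)" for A
    using ultrafilter_eventually_not[OF U] by (auto simp: eventually_filtermap)
  show "filtermap f U \<noteq> principal {n}" for n
  proof
    assume "filtermap f U = principal {n}"
    then have "eventually (\<lambda>i. i = n) (filtermap f U)"
      by (simp add: eventually_principal)
    then have "eventually (\<lambda>i. i \<in> f -` {n}) U"
      by (simp add: eventually_filtermap)
    then show False
      using ultrafilter_infinite[OF U] fin by blast
  qed
qed

definition cofinal_mod :: "nat filter \<Rightarrow> (nat \<Rightarrow> nat) set \<Rightarrow> (nat \<Rightarrow> nat) set \<Rightarrow> bool" where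
  "cofinal_mod U K D \<longleftrightarrow> D \<subseteq> K \<and> (\<forall>f\<in>K. \<exists>g\<in>D. le_mod U f g)"

lemma cof_mod_attained: "\<exists>D. cofinal_mod U K D \<and> cof_mod K U = |D|"
  and cof_mod_le: "\<And>D. cofinal_mod U K D \<Longrightarrow> cof_mod K U \<le>o |D|"
proof -
  let ?R = "{|D| | D. D \<subseteq> K \<and> (\<forall>f\<in>K. \<exists>g\<in>D. le_mod U f g)}"
  have "le_mod U f f" for f by (simp add: le_mod_def)
  then have ne: "?R \<noteq> {}" by blast
  have co: "\<forall>r\<in>?R. Card_order r" by (auto simp: card_of_Card_order)
  show "\<exists>D. cofinal_mod U K D \<and> cof_mod K U = |D|"
    using least_card(1)[OF ne co] unfolding cof_mod_def cofinal_mod_def by blast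
  show "cof_mod K U \<le>o |D|" if "cofinal_mod U K D" for D
    using least_card(2)[OF ne co] that unfolding cof_mod_def cofinal_mod_def by blast
qed

lemma uncountable_cof_mod:
  assumes "\<And>D. cofinal_mod U K D \<Longrightarrow> \<not> countable D"
  shows "natLeq <o cof_mod K U"
  using assms cof_mod_attained[of U K]
  by (metis countable_card_le_natLeq card_of_Well_order natLeq_Well_order not_ordLeq_iff_ordLess)

lemma cardinal_u_basis:
  assumes "nonprincipal_ultrafilter U"
  obtains W B where "nonprincipal_ultrafilter W" "filter_basis W B" "cardinal_u = |B|"
proof -
  have att: "\<exists>B. filter_basis W B \<and> character W = |B|" for W
  proof -
    have "filter_basis W {A. eventually (\<lambda>n. n \<in> A) W}"
      by (auto simp: filter_basis_def)
    then have "{|B| | B. filter_basis W B} \<noteq> {}" by blast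
    from least_card(1)[OF this] show ?thesis
      unfolding character_def using card_of_Card_order by blast
  qed
  then have "Card_order (character W)" for W
    using card_of_Card_order by metis
  then have "\<forall>r\<in>{character U | U. nonprincipal_ultrafilter U}. Card_order r" by blast
  from least_card(1)[OF _ this] assms
  have "cardinal_u \<in> {character U | U. nonprincipal_ultrafilter U}"
    unfolding cardinal_u_def by blast
  then show thesis using att that by force
qed

section \<open>Groupwise dense sets\<close>

lemma groupwise_dense_INT_nonempty:
  assumes "|B| <o cardinal_g" "\<And>b. b \<in> B \<Longrightarrow> groupwise_dense (G b)"
  shows "\<exists>X. \<forall>b\<in>B. X \<in> G b"
proof (rule ccontr)
  assume "\<not> ?thesis"
  then have empty: "\<Inter>(G ` B) = {}" by blast
  let ?R = "{|C| | C. (\<forall>G\<in>C. groupwise_dense G) \<and> \<Inter>C = {}}"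
  have "\<forall>G'\<in>G ` B. groupwise_dense G'" using assms(2) by auto
  with empty have "|G ` B| \<in> ?R" by (intro CollectI exI[of _ "G ` B"] conjI refl)
  moreover have "\<forall>r\<in>?R. Card_order r" by (auto simp: card_of_Card_order)
  ultimately have "cardinal_g \<le>o |G ` B|"
    unfolding cardinal_g_def by (intro least_card(2)) auto
  then have "cardinal_g \<le>o |B|" using card_of_image by (rule ordLeq_transitive)
  then show False using not_ordLess_ordLeq[OF assms(1)] by contradiction
qed

text \<open>
  Density of the two families of sets below comes from this. Cut \<open>\<omega>\<close> into blocks, each
  containing a whole interval of the partition and so long as \<open>F\<close> demands. Some residue class
  modulo 3 of blocks has its union in \<open>U\<close>. Taking one interval from every block two places
  after a block of this class leaves these blocks and their successors empty; with only two
  classes no such pair of adjacent empty blocks would exist. In the conclusion, \<open>{p..<q}\<close> is the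
  block of \<open>n\<close>, and the next block reaches at least up to \<open>F q\<close>.
\<close>

lemma interval_union_with_gaps:
  assumes U: "nonprincipal_ultrafilter U" and I: "interval_partition I"
    and F: "\<And>m. m \<le> F m"
  obtains A where "infinite A"
    "eventually (\<lambda>n. \<exists>p q. p \<le> n \<and> n < q \<and> F p \<le> q \<and> (\<Union>i\<in>A. I i) \<inter> {p..<F q} = {}) U"
proof -
  have I_bd: "\<exists>b. I k \<subseteq> {..<b}" and I_ne: "I k \<noteq> {}" for k
  proof -
    obtain a b where "a < b" "I k = {a..<b}"
      using I unfolding interval_partition_def by blast
    then show "\<exists>b. I k \<subseteq> {..<b}" "I k \<noteq> {}" by auto
  qed
  have I_eq: "k = l" if "i \<in> I k" "i \<in> I l" for i k l
    using I that unfolding interval_partition_def disjoint_family_on_def by blast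
  \<comment> \<open>Nothing relates the enumeration \<open>I\<close> to the order of \<open>\<omega>\<close>; but only finitely many intervals
    meet \<open>{..<m}\<close>, so another one lies entirely above \<open>m\<close>.\<close>
  have "\<exists>k b. I k \<subseteq> {m..<b} \<and> F m \<le> b \<and> m < b" for m
  proof -
    have "\<forall>i. \<exists>k. i \<in> I k" using I unfolding interval_partition_def by blast
    then obtain idx where idx: "\<And>i. i \<in> I (idx i)" by metis
    obtain k where k: "k \<notin> idx ` {..<m}"
      using ex_new_if_finite[of "idx ` {..<m}"] by auto
    obtain b where b: "I k \<subseteq> {..<b}" using I_bd by blast
    have "I k \<subseteq> {m..<Suc (b + F m + m)}"
    proof
      fix i assume i: "i \<in> I k"
      then have "idx i = k" using idx I_eq by blast
      then have "\<not> i < m" using k by blast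
      then show "i \<in> {m..<Suc (b + F m + m)}" using i b by auto
    qed
    moreover have "F m \<le> Suc (b + F m + m)" "m < Suc (b + F m + m)" by auto
    ultimately show ?thesis by blast
  qed
  then have "\<forall>m. \<exists>kb. I (fst kb) \<subseteq> {m..<snd kb} \<and> F m \<le> snd kb \<and> m < snd kb" by auto
  then obtain kb where "\<forall>m. I (fst (kb m)) \<subseteq> {m..<snd (kb m)} \<and> F m \<le> snd (kb m) \<and> m < snd (kb m)"
    by (rule choice[THEN exE])
  then obtain k b where kb: "\<And>m. I (k m) \<subseteq> {m..<b m}" "\<And>m. F m \<le> b m" "\<And>m. m < b m"
    using that[of "fst \<circ> kb" "snd \<circ> kb"] by auto
  define a where "a j = (b ^^ j) 0" for j
  have a0: "a 0 = 0" and aS: "a (Suc j) = b (a j)" for j by (simp_all add: a_def)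
  have mono: "strict_mono a" by (simp add: strict_mono_Suc_iff aS kb)
  have block: "\<exists>j. a j \<le> n \<and> n < a (Suc j)" for n
  proof -
    have ex: "n < a (Suc n)"
      using strict_mono_imp_increasing[OF mono, of "Suc n"] by simp
    define j where "j = (LEAST j. n < a (Suc j))"
    have j1: "n < a (Suc j)" unfolding j_def by (rule LeastI[of _ n]) (rule ex)
    have "a j \<le> n"
    proof (cases j)
      case (Suc i)
      have "\<not> n < a (Suc i)" by (rule not_less_Least) (use Suc in \<open>simp flip: j_def\<close>)
      then show ?thesis using Suc by simp
    qed (simp add: a0)
    with j1 show ?thesis by blast
  qed
  then obtain q where q: "\<And>n. a (q n) \<le> n" "\<And>n. n < a (Suc (q n))" by metis
  have "\<exists>r<3. eventually (\<lambda>n. q n mod 3 = r) U"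
  proof (rule ccontr)
    assume none: "\<not> ?thesis"
    have "eventually (\<lambda>n. q n mod 3 \<noteq> r) U" if "r < 3" for r
      unfolding ultrafilter_eventually_not[OF U] using none that by blast
    then have "eventually (\<lambda>n. \<forall>r\<in>{..<3}. q n mod 3 \<noteq> r) U"
      by (intro eventually_ball_finite) auto
    then obtain n where "\<forall>r\<in>{..<3}. q n mod 3 \<noteq> r"
      using ultrafilter_eventually_happens[OF U] by blast
    moreover have "q n mod 3 \<in> {..<3}" by simp
    ultimately show False by blast
  qed
  then obtain r where r: "r < 3" "eventually (\<lambda>n. q n mod 3 = r) U" by blast
  \<comment> \<open>The index of a block two places after one of class \<open>r\<close> is \<open>r - 1\<close> modulo 3.\<close>
  define J where "J = {j. Suc j mod 3 = r}"
  define A where "A = (\<lambda>j. k (a j)) ` J"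
  have Ika: "I (k (a j)) \<subseteq> {a j..<a (Suc j)}" for j using kb(1)[of "a j"] by (simp add: aS)
  have block_eq: "i = j" if "a i \<le> n" "n < a (Suc i)" "a j \<le> n" "n < a (Suc j)" for i j n
  proof -
    have "a i < a (Suc j)" "a j < a (Suc i)" using that by auto
    then show ?thesis by (simp add: strict_mono_less[OF mono])
  qed
  have infJ: "infinite J"
    unfolding infinite_nat_iff_unbounded_le
  proof
    fix m
    have "Suc (3 * m + (r + 2)) = r + 3 * Suc m" by simp
    then have "3 * m + (r + 2) \<in> J" unfolding J_def using r(1) by simp
    then show "\<exists>n\<ge>m. n \<in> J" by (intro exI[of _ "3 * m + (r + 2)"]) auto
  qed
  have inj: "inj (\<lambda>j. k (a j))"
  proof (rule injI)
    fix i j assume eq: "k (a i) = k (a j)"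
    obtain n where n: "n \<in> I (k (a i))" using I_ne by blast
    then have "a i \<le> n" "n < a (Suc i)" using Ika[of i] by auto
    moreover have "a j \<le> n" "n < a (Suc j)" using n Ika[of j] eq by auto
    ultimately show "i = j" by (rule block_eq)
  qed
  have infA: "infinite A"
    unfolding A_def finite_image_iff[OF inj_on_subset[OF inj subset_UNIV]] by (rule infJ)
  have residues: "Suc i mod 3 \<noteq> r" "Suc (Suc i) mod 3 \<noteq> r" if "i mod 3 = r" for i
    using that by (auto simp: mod_Suc split: if_splits)
  have "eventually (\<lambda>n. \<exists>p q. p \<le> n \<and> n < q \<and> F p \<le> q \<and>
      (\<Union>i\<in>A. I i) \<inter> {p..<F q} = {}) U"
    using r(2)
  proof (rule eventually_mono)
    fix n assume n: "q n mod 3 = r"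
    let ?j = "q n"
    have "(\<Union>i\<in>A. I i) \<inter> {a ?j..<F (a (Suc ?j))} = {}"
    proof (rule ccontr)
      assume "\<not> ?thesis"
      then obtain x j where j: "j \<in> J" "x \<in> I (k (a j))" "a ?j \<le> x" "x < F (a (Suc ?j))"
        unfolding A_def by auto
      have "F (a (Suc ?j)) \<le> a (Suc (Suc ?j))" by (simp add: aS kb)
      then have "x < a (Suc (Suc ?j))" using j by simp
      moreover have "a j \<le> x" "x < a (Suc j)" using j(2) Ika[of j] by auto
      ultimately have "a ?j < a (Suc j)" "a j < a (Suc (Suc ?j))" using j by auto
      then have "?j \<le> j" "j \<le> Suc ?j" by (auto simp: strict_mono_less[OF mono])
      then have "j = ?j \<or> j = Suc ?j" by auto
      then show False
        using residues[OF n] j(1) by (auto simp: J_def)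
    qed
    moreover have "F (a ?j) \<le> a (Suc ?j)" by (simp add: aS kb)
    ultimately show "\<exists>p q. p \<le> n \<and> n < q \<and> F p \<le> q \<and> (\<Union>i\<in>A. I i) \<inter> {p..<F q} = {}"
      using q[of n] by blast
  qed
  with infA show thesis by (rule that)
qed

lemma infinite_interval_union:
  assumes "interval_partition I" "infinite A"
  shows "infinite (\<Union>i\<in>A. I i)"
proof
  assume fin: "finite (\<Union>i\<in>A. I i)"
  have "I i \<noteq> {}" for i
  proof -
    obtain a b where "a < b" "I i = {a..<b}"
      using assms(1) unfolding interval_partition_def by blast
    then show ?thesis by auto
  qed
  then have "\<forall>i. \<exists>x. x \<in> I i" by blast
  then obtain x where x: "\<And>i. x i \<in> I i" by metis
  have "inj x"
  proof (rule injI)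
    fix i j assume "x i = x j"
    then have "x i \<in> I i \<inter> I j" using x[of i] x[of j] by simp
    then show "i = j"
      using assms(1) unfolding interval_partition_def disjoint_family_on_def by blast
  qed
  then have "infinite (x ` A)"
    using assms(2) finite_image_iff[OF inj_on_subset[OF _ subset_UNIV]] by metis
  moreover have "x ` A \<subseteq> (\<Union>i\<in>A. I i)" using x by blast
  ultimately show False using fin finite_subset by blast
qed

lemma sym_diff_finite_bound:
  fixes X Y :: "nat set"
  assumes "finite (sym_diff X Y)"
  shows "\<exists>k. \<forall>n\<ge>k. n \<in> X \<longleftrightarrow> n \<in> Y"
proof -
  obtain k where k: "\<forall>n\<in>sym_diff X Y. n < k"
    using assms finite_nat_set_iff_bounded by blast
  have "n \<in> X \<longleftrightarrow> n \<in> Y" if "k \<le> n" for n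
    using k that by (metis DiffI UnI1 UnI2 not_le)
  then show ?thesis by blast
qed

lemma infinite_sym_diff:
  assumes "infinite X" "finite (sym_diff X Y)"
  shows "infinite Y"
proof
  assume "finite Y"
  then have "finite (sym_diff X Y \<union> Y)" using assms(2) by blast
  moreover have "X \<subseteq> sym_diff X Y \<union> Y" by blast
  ultimately show False using assms(1) finite_subset by blast
qed

section \<open>Fewer than g functions are not cofinal in an ultrapower\<close>

text \<open>
  For a set \<open>X\<close> in this family, the next element of \<open>X\<close> after \<open>n\<close> exceeds \<open>f n\<close> for almost all
  \<open>n\<close> modulo \<open>U\<close>. If \<open>F\<close> majorizes \<open>f\<close>, the empty block after that of \<open>n\<close> is long enough.
\<close>

lemma groupwise_dense_function_gaps:
  assumes U: "nonprincipal_ultrafilter U"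
  shows "groupwise_dense {X. infinite X \<and> eventually (\<lambda>n. X \<inter> {n<..f n} = {}) U}"
    (is "groupwise_dense ?G")
  unfolding groupwise_dense_def
proof (intro conjI ballI allI impI)
  fix X Y assume X: "X \<in> ?G" and Y: "Y \<subseteq> X" "infinite Y"
  from X have "eventually (\<lambda>n. X \<inter> {n<..f n} = {}) U" by blast
  then have "eventually (\<lambda>n. Y \<inter> {n<..f n} = {}) U" by (rule eventually_mono) (use Y in blast)
  then show "Y \<in> ?G" using Y by blast
next
  fix X Y assume X: "X \<in> ?G" and fin: "finite (sym_diff X Y)"
  obtain k where k: "\<forall>n\<ge>k. n \<in> X \<longleftrightarrow> n \<in> Y"
    using sym_diff_finite_bound[OF fin] by blast
  from X have "eventually (\<lambda>n. X \<inter> {n<..f n} = {}) U" by blast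
  with ultrafilter_ge[OF U, of k] have "eventually (\<lambda>n. Y \<inter> {n<..f n} = {}) U"
  proof eventually_elim
    case (elim n)
    show ?case
    proof (rule ccontr)
      assume "\<not> ?case"
      then obtain i where i: "i \<in> Y" "i \<in> {n<..f n}" by blast
      then have "i \<in> X" using k elim(1) by simp
      then show False using i(2) elim(2) by blast
    qed
  qed
  then show "Y \<in> ?G" using X infinite_sym_diff[OF _ fin] by blast
next
  fix I assume I: "interval_partition I"
  define F where "F m = m + (\<Sum>i\<le>m. Suc (f i))" for m
  have f_less: "f n < F q" if "n < q" for n q
  proof -
    have "Suc (f n) \<le> (\<Sum>i\<le>q. Suc (f i))"
      by (rule member_le_sum) (use that in auto)
    then show ?thesis by (simp add: F_def)
  qed
  have "\<And>m. m \<le> F m" by (simp add: F_def)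
  from interval_union_with_gaps[OF U I this] obtain A where A: "infinite A"
    "eventually (\<lambda>n. \<exists>p q. p \<le> n \<and> n < q \<and> F p \<le> q \<and> (\<Union>i\<in>A. I i) \<inter> {p..<F q} = {}) U"
    by blast
  have "eventually (\<lambda>n. (\<Union>i\<in>A. I i) \<inter> {n<..f n} = {}) U"
    using A(2)
  proof (rule eventually_mono)
    fix n assume "\<exists>p q. p \<le> n \<and> n < q \<and> F p \<le> q \<and> (\<Union>i\<in>A. I i) \<inter> {p..<F q} = {}"
    then obtain p q where pq: "p \<le> n" "n < q" "(\<Union>i\<in>A. I i) \<inter> {p..<F q} = {}" by blast
    then have "{n<..f n} \<subseteq> {p..<F q}" using f_less[of n q] by auto
    then show "(\<Union>i\<in>A. I i) \<inter> {n<..f n} = {}" using pq(3) by blast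
  qed
  then show "\<exists>A. infinite A \<and> (\<Union>i\<in>A. I i) \<in> ?G"
    using A(1) infinite_interval_union[OF I] by blast
qed blast

definition next_in :: "nat set \<Rightarrow> nat \<Rightarrow> nat" where
  "next_in X n = (LEAST m. n < m \<and> m \<in> X)"

lemma next_in:
  assumes "infinite X"
  shows "n < next_in X n" "next_in X n \<in> X"
proof -
  have "\<exists>m. n < m \<and> m \<in> X" using assms infinite_nat_iff_unbounded by blast
  from LeastI_ex[OF this] show "n < next_in X n" "next_in X n \<in> X"
    unfolding next_in_def by blast+
qed

lemma next_in_le: "n < m \<Longrightarrow> m \<in> X \<Longrightarrow> next_in X n \<le> m"
  unfolding next_in_def by (rule Least_le) blast

text \<open>
  A common element \<open>X\<close> of the sets of the previous kind, one for each \<open>f b\<close>, has a next-element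
  function that strictly exceeds every \<open>f b\<close> modulo \<open>U\<close>.
\<close>

lemma fewer_than_g_not_cofinal:
  assumes U: "nonprincipal_ultrafilter U" and B: "|B| <o cardinal_g"
  shows "\<exists>h. \<forall>b\<in>B. \<not> le_mod U h (f b)"
proof -
  obtain X where X: "\<forall>b\<in>B. X \<in> {X. infinite X \<and> eventually (\<lambda>n. X \<inter> {n<..f b n} = {}) U}"
    using groupwise_dense_INT_nonempty[OF B groupwise_dense_function_gaps[OF U]] ..
  show ?thesis
  proof (intro exI ballI)
    fix b assume "b \<in> B"
    with X have "X \<in> {X. infinite X \<and> eventually (\<lambda>n. X \<inter> {n<..f b n} = {}) U}" ..
    then have inf: "infinite X" and
      ev: "eventually (\<lambda>n. X \<inter> {n<..f b n} = {}) U" by auto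
    have "eventually (\<lambda>n. \<not> next_in X n \<le> f b n) U"
      using ev
    proof (rule eventually_mono)
      fix n assume "X \<inter> {n<..f b n} = {}"
      then have "next_in X n \<notin> {n<..f b n}" using next_in(2)[OF inf, of n] by blast
      then show "\<not> next_in X n \<le> f b n" using next_in(1)[OF inf, of n] by simp
    qed
    then show "\<not> le_mod U (next_in X) (f b)"
      unfolding le_mod_def using ultrafilter_eventually_not[OF U] by blast
  qed
qed

section \<open>Finite-to-one images of small character\<close>

text \<open>
  The elements of \<open>X\<close> cut \<open>\<omega>\<close> into intervals, and \<open>X \<inter> {min b n<..max b n} = {}\<close> says that \<open>b\<close>
  and \<open>n\<close> lie in the same one. So \<open>X\<close> belongs to this family if the union of its intervals that
  meet \<open>B\<close> is in \<open>U\<close>. A smaller \<open>X\<close> has longer intervals, which makes this union larger. For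
  density, the blocks are chosen so long that each of them meets \<open>B\<close>.
\<close>

lemma groupwise_dense_saturation:
  assumes U: "nonprincipal_ultrafilter U" and B: "infinite B"
  shows "groupwise_dense {X. infinite X \<and>
    eventually (\<lambda>n. \<exists>b\<in>B. X \<inter> {min b n<..max b n} = {}) U}"
    (is "groupwise_dense ?G")
  unfolding groupwise_dense_def
proof (intro conjI ballI allI impI)
  fix X Y assume X: "X \<in> ?G" and Y: "Y \<subseteq> X" "infinite Y"
  from X have "eventually (\<lambda>n. \<exists>b\<in>B. X \<inter> {min b n<..max b n} = {}) U" by blast
  then have "eventually (\<lambda>n. \<exists>b\<in>B. Y \<inter> {min b n<..max b n} = {}) U"
  proof (rule eventually_mono)
    fix n assume "\<exists>b\<in>B. X \<inter> {min b n<..max b n} = {}"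
    then obtain b where "b \<in> B" "X \<inter> {min b n<..max b n} = {}" ..
    moreover from this(2) Y(1) have "Y \<inter> {min b n<..max b n} = {}" by blast
    ultimately show "\<exists>b\<in>B. Y \<inter> {min b n<..max b n} = {}" by (intro bexI)
  qed
  then show "Y \<in> ?G" using Y by blast
next
  fix X Y assume X: "X \<in> ?G" and fin: "finite (sym_diff X Y)"
  obtain k where k: "\<forall>n\<ge>k. n \<in> X \<longleftrightarrow> n \<in> Y"
    using sym_diff_finite_bound[OF fin] by blast
  \<comment> \<open>Beyond an element of \<open>X\<close> above \<open>k\<close>, no interval of \<open>X\<close> reaches below \<open>k\<close>.\<close>
  obtain x where x: "x \<in> X" "k \<le> x" using X infinite_nat_iff_unbounded_le by blast
  from X have "eventually (\<lambda>n. \<exists>b\<in>B. X \<inter> {min b n<..max b n} = {}) U" by blast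
  with ultrafilter_ge[OF U, of x]
  have "eventually (\<lambda>n. \<exists>b\<in>B. Y \<inter> {min b n<..max b n} = {}) U"
  proof eventually_elim
    case (elim n)
    then obtain b where b: "b \<in> B" "X \<inter> {min b n<..max b n} = {}" by blast
    have "x \<le> b"
    proof (rule ccontr)
      assume "\<not> x \<le> b"
      then have "x \<in> {min b n<..max b n}" using elim by auto
      then show False using b x by blast
    qed
    then have "i \<in> X" if "i \<in> Y" "i \<in> {min b n<..max b n}" for i
      using k x(2) elim(1) that by auto
    then have "Y \<inter> {min b n<..max b n} = {}" using b(2) by blast
    then show ?case using b(1) by blast
  qed
  then show "Y \<in> ?G" using X infinite_sym_diff[OF _ fin] by blast
next
  fix I assume I: "interval_partition I"
  have "\<forall>m. \<exists>b. m \<le> b \<and> b \<in> B" using B infinite_nat_iff_unbounded_le by blast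
  then obtain e where e: "\<And>m. m \<le> e m" "\<And>m. e m \<in> B" by metis
  define F where "F m = Suc (e m)" for m
  have F: "\<And>m. m \<le> F m" using e(1) by (simp add: F_def le_SucI)
  from interval_union_with_gaps[OF U I F] obtain A where A: "infinite A"
    "eventually (\<lambda>n. \<exists>p q. p \<le> n \<and> n < q \<and> F p \<le> q \<and> (\<Union>i\<in>A. I i) \<inter> {p..<F q} = {}) U"
    by blast
  have "eventually (\<lambda>n. \<exists>b\<in>B. (\<Union>i\<in>A. I i) \<inter> {min b n<..max b n} = {}) U"
    using A(2)
  proof (rule eventually_mono)
    fix n assume "\<exists>p q. p \<le> n \<and> n < q \<and> F p \<le> q \<and> (\<Union>i\<in>A. I i) \<inter> {p..<F q} = {}"
    then obtain p q where pq: "p \<le> n" "n < q" "F p \<le> q" "(\<Union>i\<in>A. I i) \<inter> {p..<F q} = {}"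
      by blast
    have "{min (e p) n<..max (e p) n} \<subseteq> {p..<F q}"
      using pq(1-3) e(1)[of p] F[of q] by (auto simp: F_def)
    then show "\<exists>b\<in>B. (\<Union>i\<in>A. I i) \<inter> {min b n<..max b n} = {}"
      using pq(4) e(2) by blast
  qed
  then show "\<exists>A. infinite A \<and> (\<Union>i\<in>A. I i) \<in> ?G"
    using A(1) infinite_interval_union[OF I] by blast
qed blast

definition interval_index :: "nat set \<Rightarrow> nat \<Rightarrow> nat" where
  "interval_index X n = card (X \<inter> {..n})"

lemma interval_index_eqI:
  assumes "X \<inter> {min b n<..max b n} = {}"
  shows "interval_index X b = interval_index X n"
proof -
  have "X \<inter> {..b} = X \<inter> {..n}"
  proof (cases "b \<le> n")
    case True
    then have "X \<inter> {b<..n} = {}" using assms by simp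
    with True show ?thesis by force
  next
    case False
    then have "X \<inter> {n<..b} = {}" using assms by (simp add: min_def max_def)
    with False show ?thesis by force
  qed
  then show ?thesis by (simp add: interval_index_def)
qed

lemma finite_interval_index_fibre:
  assumes "infinite X"
  shows "finite (interval_index X -` {k})"
proof -
  obtain S where S: "S \<subseteq> X" "finite S" "card S = Suc k"
    using infinite_arbitrarily_large[OF assms] by blast
  obtain m where m: "\<forall>s\<in>S. s < m" using S(2) finite_nat_set_iff_bounded by blast
  have "n < m" if "interval_index X n = k" for n
  proof (rule ccontr)
    assume "\<not> n < m"
    then have "S \<subseteq> X \<inter> {..n}" using S(1) m by fastforce
    then have "Suc k \<le> interval_index X n"
      unfolding interval_index_def using S(3) by (metis card_mono finite_Int finite_atMost)
    then show False using that by simp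
  qed
  then have "interval_index X -` {k} \<subseteq> {..<m}" by auto
  then show ?thesis by (rule finite_subset) simp
qed

text \<open>
  The near coherence argument. Collapse the intervals of a set \<open>X\<close> that lies in all the
  families above for basis sets \<open>b\<close> of \<open>W\<close>. The image \<open>f ` b\<close> of each of them is then in the image
  \<open>V\<close> of \<open>U\<close>. As \<open>V\<close> and the image of \<open>W\<close> are ultrafilters, they are equal, and the sets \<open>f ` b\<close>
  form a basis of \<open>V\<close>.
\<close>

lemma finite_to_one_image_small_character:
  assumes U: "nonprincipal_ultrafilter U" and W: "nonprincipal_ultrafilter W"
    and B: "filter_basis W B" and small: "|B| <o cardinal_g"
  obtains f C where "nonprincipal_ultrafilter (filtermap f U)"
    "filter_basis (filtermap f U) C" "|C| \<le>o |B|"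
proof -
  have inf: "infinite b" if "b \<in> B" for b
    using that B ultrafilter_infinite[OF W] unfolding filter_basis_def by blast
  obtain X where "\<forall>b\<in>B. X \<in> {X. infinite X \<and>
      eventually (\<lambda>n. \<exists>i\<in>b. X \<inter> {min i n<..max i n} = {}) U}"
    using groupwise_dense_INT_nonempty[OF small groupwise_dense_saturation[OF U inf]] ..
  then have X: "infinite X" "eventually (\<lambda>n. \<exists>i\<in>b. X \<inter> {min i n<..max i n} = {}) U"
    if "b \<in> B" for b using that by simp_all
  obtain b0 where "b0 \<in> B" using B unfolding filter_basis_def
    by (metis UNIV_I always_eventually)
  then have infX: "infinite X" by (rule X(1))
  define f where "f = interval_index X"
  have V: "nonprincipal_ultrafilter (filtermap f U)"
    unfolding f_def using U finite_interval_index_fibre[OF infX]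
    by (rule nonprincipal_ultrafilter_filtermap)
  have img: "eventually (\<lambda>n. n \<in> f ` b) (filtermap f U)" if "b \<in> B" for b
  proof -
    have "eventually (\<lambda>n. f n \<in> f ` b) U"
      using X(2)[OF that]
    proof (rule eventually_mono)
      fix n assume "\<exists>i\<in>b. X \<inter> {min i n<..max i n} = {}"
      then obtain i where i: "i \<in> b" "X \<inter> {min i n<..max i n} = {}" ..
      from i(2) have "f i = f n" unfolding f_def by (rule interval_index_eqI)
      then show "f n \<in> f ` b" using i(1) by (metis imageI)
    qed
    then show ?thesis by (simp add: eventually_filtermap)
  qed
  have "filter_basis (filtermap f U) ((`) f ` B)"
    unfolding filter_basis_def
  proof (intro conjI allI impI)
    show "(`) f ` B \<subseteq> {A. eventually (\<lambda>n. n \<in> A) (filtermap f U)}" using img by blast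
    fix A assume A: "eventually (\<lambda>n. n \<in> A) (filtermap f U)"
    have "eventually (\<lambda>n. n \<in> f -` A) W"
    proof (rule ccontr)
      assume "\<not> ?thesis"
      then have "eventually (\<lambda>n. n \<in> - (f -` A)) W"
        using ultrafilter_eventually_not[OF W] by simp
      then obtain b where b: "b \<in> B" "b \<subseteq> - (f -` A)"
        using B unfolding filter_basis_def by blast
      from eventually_conj[OF A img[OF b(1)]] obtain n where "n \<in> A" "n \<in> f ` b"
        using ultrafilter_eventually_happens[OF V] by blast
      then show False using b(2) by blast
    qed
    then obtain b where "b \<in> B" "b \<subseteq> f -` A" using B unfolding filter_basis_def by blast
    then show "\<exists>V\<in>(`) f ` B. V \<subseteq> A" by blast
  qed
  then show thesis using that[OF V] card_of_image by blast
qed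

section \<open>The compact set of truncated next-element functions\<close>

text \<open>
  Ketonen's argument. Let \<open>Z i\<close> decrease through \<open>V\<close>. For any \<open>h\<close>, the union of the sets
  \<open>Z i \<inter> {..<h i}\<close> is almost contained in each \<open>Z i\<close>. It meets a basis set \<open>b\<close> as soon as \<open>h\<close>
  exceeds, at one place \<open>i\<close>, the function that chooses an element of \<open>b \<inter> Z i\<close>; as these
  functions are not cofinal modulo \<open>V\<close>, one \<open>h\<close> does this for all \<open>b\<close>. A set that meets all basis
  sets of an ultrafilter is in the ultrafilter.
\<close>

lemma P_point_of_small_character:
  assumes V: "nonprincipal_ultrafilter V" and B: "filter_basis V B"
    and small: "|B| <o cardinal_g"
    and Y: "\<And>i :: nat. eventually (\<lambda>n. n \<in> Y i) V"
  obtains X where "eventually (\<lambda>n. n \<in> X) V" "\<forall>i. finite (X - Y i)"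
proof -
  define Z where "Z i = (\<Inter>j\<le>i. Y j)" for i
  have Z: "eventually (\<lambda>n. n \<in> Z i) V" for i
    unfolding Z_def using Y by (simp add: eventually_ball_finite)
  have "\<exists>m. m \<in> b \<inter> Z i" if "b \<in> B" for b i
  proof -
    have "eventually (\<lambda>n. n \<in> b) V" using that B unfolding filter_basis_def by blast
    from ultrafilter_eventually_happens[OF V eventually_conj[OF this Z]] show ?thesis by blast
  qed
  then obtain e where e: "\<And>b i. b \<in> B \<Longrightarrow> e b i \<in> b \<inter> Z i" by metis
  obtain h where h: "\<forall>b\<in>B. \<not> le_mod V h (e b)"
    using fewer_than_g_not_cofinal[OF V small] ..
  define X where "X = (\<Union>i. Z i \<inter> {..<h i})"
  have meets: "b \<inter> X \<noteq> {}" if "b \<in> B" for b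
  proof -
    have "\<not> (\<forall>i. h i \<le> e b i)"
      using bspec[OF h that] always_eventually unfolding le_mod_def by blast
    then obtain i where "e b i < h i" by (auto simp: not_le)
    then have "e b i \<in> b \<inter> X" using e[OF that, of i] unfolding X_def by blast
    then show ?thesis by blast
  qed
  have "eventually (\<lambda>n. n \<in> X) V"
  proof (rule ccontr)
    assume "\<not> ?thesis"
    then have "eventually (\<lambda>n. n \<in> - X) V" using ultrafilter_eventually_not[OF V] by simp
    then obtain b where "b \<in> B" "b \<subseteq> - X" using B unfolding filter_basis_def by blast
    then show False using meets by blast
  qed
  moreover have "finite (X - Y i)" for i
  proof (rule finite_subset)
    show "X - Y i \<subseteq> (\<Union>j<i. {..<h j})"
    proof
      fix x assume x: "x \<in> X - Y i"
      then obtain j where j: "x \<in> Z j" "x < h j" unfolding X_def by blast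
      then have "j < i" using x unfolding Z_def by (meson DiffD2 INT_E atMost_iff not_le)
      then show "x \<in> (\<Union>j<i. {..<h j})" using j by blast
    qed
  qed simp
  ultimately show thesis using that by blast
qed

text \<open>
  Such a \<open>\<phi>\<close> is continuous on the Cantor space, which appears here as the compact set of
  functions from \<open>nat\<close> to \<open>{0, 1}\<close>.
\<close>

lemma compact_range_finitely_determined:
  fixes \<phi> :: "nat set \<Rightarrow> nat \<Rightarrow> nat"
  assumes "\<And>n. \<exists>m. \<forall>X Y. X \<inter> {..m} = Y \<inter> {..m} \<longrightarrow> \<phi> X n = \<phi> Y n"
  shows "compact (range \<phi>)"
proof -
  let ?S = "PiE UNIV (\<lambda>_. {0, 1}) :: (nat \<Rightarrow> nat) set"
  let ?set = "\<lambda>y :: nat \<Rightarrow> nat. {i. y i = 1}"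
  have "compact ?S"
    using compactin_PiE[of "\<lambda>_. euclidean" UNIV "\<lambda>_. {0, 1::nat}"]
    by (simp add: euclidean_product_topology)
  moreover have "continuous_on UNIV (\<lambda>y. \<phi> (?set y))"
  proof (rule continuous_on_coordinatewise_then_product)
    fix n
    obtain m where m: "\<And>X Y. X \<inter> {..m} = Y \<inter> {..m} \<Longrightarrow> \<phi> X n = \<phi> Y n"
      using assms by blast
    have "open ((\<lambda>y. \<phi> (?set y) n) -` T)" for T
      unfolding open_subopen[of "(\<lambda>y. \<phi> (?set y) n) -` T"]
    proof
      fix y assume y: "y \<in> (\<lambda>y. \<phi> (?set y) n) -` T"
      have "open {z. \<forall>i\<in>{..m}. z i \<in> {y i}}"
        by (rule product_topology_basis') (auto simp: open_discrete)
      moreover have "{z. \<forall>i\<in>{..m}. z i \<in> {y i}} \<subseteq> (\<lambda>y. \<phi> (?set y) n) -` T"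
      proof
        fix z assume "z \<in> {z. \<forall>i\<in>{..m}. z i \<in> {y i}}"
        then have "?set z \<inter> {..m} = ?set y \<inter> {..m}" by auto
        from m[OF this] show "z \<in> (\<lambda>y. \<phi> (?set y) n) -` T" using y by simp
      qed
      ultimately show "\<exists>T'. open T' \<and> y \<in> T' \<and> T' \<subseteq> (\<lambda>y. \<phi> (?set y) n) -` T"
        by (intro exI[of _ "{z. \<forall>i\<in>{..m}. z i \<in> {y i}}"]) auto
    qed
    then show "continuous_on UNIV (\<lambda>y. \<phi> (?set y) n)"
      by (simp add: continuous_on_open_vimage)
  qed
  ultimately have "compact ((\<lambda>y. \<phi> (?set y)) ` ?S)"
    by (intro compact_continuous_image) (rule continuous_on_subset, auto)
  moreover have "(\<lambda>y. \<phi> (?set y)) ` ?S = range \<phi>"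
  proof -
    have "\<phi> X \<in> (\<lambda>y. \<phi> (?set y)) ` ?S" for X
      by (rule image_eqI[of _ _ "\<lambda>i. if i \<in> X then 1 else 0"]) (auto split: if_splits)
    then show ?thesis by blast
  qed
  ultimately show ?thesis by simp
qed

text \<open>
  The value is the next element of \<open>X \<union> {h n..}\<close>, not the minimum of \<open>h n\<close> and the next element
  of \<open>X\<close>; it thus makes sense for finite \<open>X\<close> and is greater than \<open>n\<close> in any case.
  The value \<open>0\<close> outside \<open>X\<close> makes the sets \<open>X\<close> that are not in the ultrafilter negligible.
\<close>

definition truncated_next :: "(nat \<Rightarrow> nat) \<Rightarrow> nat set \<Rightarrow> nat \<Rightarrow> nat" where
  "truncated_next h X n = (if n \<in> X then LEAST m. n < m \<and> (m \<in> X \<or> h n \<le> m) else 0)"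

lemma truncated_next_in:
  assumes "n \<in> X"
  shows "n < truncated_next h X n" "truncated_next h X n \<in> X \<or> h n \<le> truncated_next h X n"
proof -
  have "\<exists>m. n < m \<and> (m \<in> X \<or> h n \<le> m)" by (intro exI[of _ "Suc (max n (h n))"]) auto
  from LeastI_ex[OF this] show "n < truncated_next h X n"
    "truncated_next h X n \<in> X \<or> h n \<le> truncated_next h X n"
    unfolding truncated_next_def using assms by auto
qed

lemma truncated_next_le:
  assumes "n < m" "m \<in> X \<or> h n \<le> m"
  shows "truncated_next h X n \<le> m"
  unfolding truncated_next_def using assms by (auto intro!: Least_le)

lemma compact_truncated_next: "compact (range (truncated_next h))"
proof (rule compact_range_finitely_determined)
  fix n
  let ?b = "Suc (max n (h n))"
  have "truncated_next h X n \<le> truncated_next h Y n" if "X \<inter> {..?b} = Y \<inter> {..?b}" for X Y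
  proof (cases "n \<in> X")
    case True
    then have Y: "n \<in> Y" using that by fastforce
    have "truncated_next h Y n \<le> ?b" by (rule truncated_next_le) auto
    then have "truncated_next h Y n \<in> X \<or> h n \<le> truncated_next h Y n"
      using truncated_next_in(2)[OF Y, of h] that by (metis IntD1 IntI atMost_iff)
    then show ?thesis using truncated_next_in(1)[OF Y] by (intro truncated_next_le)
  qed (simp add: truncated_next_def)
  then show "\<exists>m. \<forall>X Y. X \<inter> {..m} = Y \<inter> {..m} \<longrightarrow> truncated_next h X n = truncated_next h Y n"
    by (intro exI[of _ ?b]) (metis order_antisym)
qed

text \<open>
  On a basis set \<open>b \<subseteq> X\<close>, the next element of \<open>b\<close> is at least the next element of \<open>X\<close>. If \<open>X\<close> is
  not in \<open>V\<close>, its function is \<open>0\<close> modulo \<open>V\<close>.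
\<close>

lemma cofinal_truncated_next_basis:
  assumes V: "nonprincipal_ultrafilter V" and B: "filter_basis V B"
  shows "cofinal_mod V (range (truncated_next h)) (truncated_next h ` B)"
  unfolding cofinal_mod_def
proof (intro conjI ballI)
  fix g assume "g \<in> range (truncated_next h)"
  then obtain X where g: "g = truncated_next h X" by blast
  show "\<exists>g'\<in>truncated_next h ` B. le_mod V g g'"
  proof (cases "eventually (\<lambda>n. n \<in> X) V")
    case True
    then obtain b where b: "b \<in> B" "b \<subseteq> X" using B unfolding filter_basis_def by blast
    then have "eventually (\<lambda>n. n \<in> b) V" using B unfolding filter_basis_def by blast
    then have "le_mod V g (truncated_next h b)"
      unfolding le_mod_def g
    proof (rule eventually_mono)
      fix n assume n: "n \<in> b"
      show "truncated_next h X n \<le> truncated_next h b n"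
        using truncated_next_in[OF n, of h] b(2) by (intro truncated_next_le) auto
    qed
    then show ?thesis using b(1) by blast
  next
    case False
    then have "eventually (\<lambda>n. n \<notin> X) V" using ultrafilter_eventually_not[OF V] by simp
    then have "le_mod V g g'" for g'
      unfolding le_mod_def g by (rule eventually_mono) (simp add: truncated_next_def)
    moreover obtain b where "b \<in> B" using B unfolding filter_basis_def
      by (metis UNIV_I always_eventually)
    ultimately show ?thesis by blast
  qed
qed blast

text \<open>
  The elements of \<open>X\<close> with even and those with odd position in \<open>X\<close> form two sets, one of which is
  in \<open>V\<close>.
\<close>

lemma ultrafilter_alternate_elements:
  assumes V: "nonprincipal_ultrafilter V" and X: "eventually (\<lambda>n. n \<in> X) V"
  obtains Z where "eventually (\<lambda>n. n \<in> Z) V" "Z \<subseteq> X" "\<forall>n\<in>Z. next_in X n \<notin> Z"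
proof -
  have inf: "infinite X" using V X by (rule ultrafilter_infinite)
  define Z where "Z P = {n \<in> X. even (interval_index X n) = P}" for P
  have index_next: "interval_index X (next_in X n) = Suc (interval_index X n)" for n
  proof -
    let ?m = "next_in X n"
    have m: "n < ?m" "?m \<in> X" by (rule next_in[OF inf])+
    have "x = ?m \<or> x \<le> n" if "x \<in> X" "x \<le> ?m" for x
      using that next_in_le[of n x X] by linarith
    then have "X \<inter> {..?m} = insert ?m (X \<inter> {..n})" using m by auto
    then show ?thesis using m(1) by (simp add: interval_index_def)
  qed
  have "\<exists>P. eventually (\<lambda>n. n \<in> Z P) V"
  proof (rule ccontr)
    assume "\<nexists>P. eventually (\<lambda>n. n \<in> Z P) V"
    then have "eventually (\<lambda>n. n \<notin> Z True) V" "eventually (\<lambda>n. n \<notin> Z False) V"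
      unfolding ultrafilter_eventually_not[OF V] by blast+
    with X have "eventually (\<lambda>n. False) V" by eventually_elim (simp add: Z_def)
    then show False using ultrafilter_eventually_happens[OF V] by blast
  qed
  then obtain P where "eventually (\<lambda>n. n \<in> Z P) V" by blast
  then show thesis
  proof (rule that)
    show "Z P \<subseteq> X" by (auto simp: Z_def)
    show "\<forall>n\<in>Z P. next_in X n \<notin> Z P"
      using index_next by (auto simp: Z_def)
  qed
qed

text \<open>
  Given countably many sets \<open>X'\<close>, let \<open>X\<close> be a pseudo-intersection of those in \<open>V\<close>, and let \<open>Z\<close> be
  half of \<open>X\<close>. From almost every \<open>n \<in> Z\<close>, the next element of \<open>X'\<close> is at most that of \<open>X\<close>, and this
  is strictly less than that of \<open>Z\<close>. The hypothesis on \<open>h\<close> ensures that \<open>h n\<close> lies beyond the next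
  element of \<open>Z\<close>, and hence of \<open>X\<close>, so that the strict inequality survives truncation.
\<close>

lemma uncountable_cofinal_truncated_next:
  assumes V: "nonprincipal_ultrafilter V" and B: "filter_basis V B"
    and small: "|B| <o cardinal_g"
    and h: "\<forall>b\<in>B. \<not> le_mod V h (next_in b)"
    and D: "cofinal_mod V (range (truncated_next h)) D"
  shows "\<not> countable D"
proof
  assume "countable D"
  then have "\<exists>C. countable C \<and> D = truncated_next h ` C"
    using D countable_subset_image[of D "truncated_next h" UNIV] unfolding cofinal_mod_def by blast
  then obtain C where C: "countable C" "D = truncated_next h ` C" by blast
  \<comment> \<open>\<open>UNIV\<close> is added to have a nonempty set to enumerate.\<close>
  define C' where "C' = insert UNIV {X \<in> C. eventually (\<lambda>n. n \<in> X) V}"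
  define Y where "Y = from_nat_into C'"
  have "countable C'" "C' \<noteq> {}" using C(1) by (auto simp: C'_def)
  then have Y: "range Y = C'" unfolding Y_def by (simp add: range_from_nat_into)
  then have Y_mem: "eventually (\<lambda>n. n \<in> Y i) V" for i
    using rangeI[of Y i] by (auto simp: C'_def)
  obtain X where X: "eventually (\<lambda>n. n \<in> X) V" "\<forall>i. finite (X - Y i)"
    by (rule P_point_of_small_character[where Y = Y, OF V B small Y_mem])
  obtain Z where Z: "eventually (\<lambda>n. n \<in> Z) V" "Z \<subseteq> X" "\<forall>n\<in>Z. next_in X n \<notin> Z"
    by (rule ultrafilter_alternate_elements[OF V X(1)])
  have inf: "infinite X" by (rule ultrafilter_infinite[OF V X(1)])
  obtain b where b: "b \<in> B" "b \<subseteq> Z" using Z(1) B unfolding filter_basis_def by blast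
  have infb: "infinite b"
    using b(1) B ultrafilter_infinite[OF V] unfolding filter_basis_def by blast
  have below: "eventually (\<lambda>n. next_in b n < h n) V"
    using bspec[OF h b(1)] ultrafilter_eventually_not[OF V, of "\<lambda>n. h n \<le> next_in b n"]
    unfolding le_mod_def by (simp add: not_le)
  obtain X' where X': "X' \<in> C" "le_mod V (truncated_next h Z) (truncated_next h X')"
    using D C(2) unfolding cofinal_mod_def by blast
  then have le: "eventually (\<lambda>n. truncated_next h Z n \<le> truncated_next h X' n) V"
    by (simp add: le_mod_def)
  have "eventually (\<lambda>n. n \<in> X') V"
  proof (rule ccontr)
    assume "\<not> ?thesis"
    then have "eventually (\<lambda>n. n \<notin> X') V" using ultrafilter_eventually_not[OF V] by simp
    with le Z(1) have "eventually (\<lambda>n. False) V"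
    proof eventually_elim
      case (elim n)
      then show ?case using truncated_next_in(1)[of n Z h] by (simp add: truncated_next_def[of h X'])
    qed
    then show False using ultrafilter_eventually_happens[OF V] by blast
  qed
  then have "X' \<in> C'" using X'(1) by (simp add: C'_def)
  then obtain i where "X' = Y i" using Y by blast
  then have "finite (X - X')" using X(2) by simp
  then obtain k where k: "\<forall>n\<in>X - X'. n < k" using finite_nat_set_iff_bounded by blast
  from le below Z(1) ultrafilter_ge[OF V, of k] have "eventually (\<lambda>n. False) V"
  proof eventually_elim
    case (elim n)
    let ?m = "next_in X n" and ?l = "truncated_next h Z n"
    have m: "n < ?m" "?m \<in> X" by (rule next_in[OF inf])+
    then have "?m \<in> X'" using k elim(4) by (metis DiffI le_less_trans less_asym)
    then have "truncated_next h X' n \<le> ?m" using m(1) by (intro truncated_next_le) auto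
    moreover have "?m < ?l"
    proof (cases "h n \<le> ?l")
      case True
      have "?m \<le> next_in b n"
        using next_in[OF infb] b(2) Z(2) by (intro next_in_le) blast+
      then show ?thesis using True elim(2) by simp
    next
      case False
      then have l: "n < ?l" "?l \<in> Z" using truncated_next_in[OF elim(3), of h] by auto
      then have "?m \<le> ?l" using Z(2) by (intro next_in_le) auto
      moreover have "?m \<noteq> ?l" using l(2) Z(3) elim(3) by metis
      ultimately show ?thesis by simp
    qed
    ultimately show ?case using elim(1) by simp
  qed
  then show False using ultrafilter_eventually_happens[OF V] by blast
qed

section \<open>No Michael ultrafilters\<close>

lemma le_mod_filtermap: "le_mod (filtermap f U) g g' \<longleftrightarrow> le_mod U (g \<circ> f) (g' \<circ> f)"
  by (simp add: le_mod_def eventually_filtermap)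

lemma cofinal_mod_filtermap:
  assumes "D \<subseteq> K"
  shows "cofinal_mod U ((\<lambda>g. g \<circ> f) ` K) ((\<lambda>g. g \<circ> f) ` D) \<longleftrightarrow> cofinal_mod (filtermap f U) K D"
  unfolding cofinal_mod_def le_mod_filtermap using assms by auto

theorem theorem3p10:
  assumes "cardinal_u <o cardinal_g"
  shows "\<forall>U. nonprincipal_ultrafilter U \<longrightarrow> \<not> Michael_ultrafilter U"
proof (intro allI impI notI)
  fix U assume U: "nonprincipal_ultrafilter U" and "Michael_ultrafilter U"
  then have Michael: "cof_mod UNIV U \<le>o cof_mod K U"
    if "compact K" "natLeq <o cof_mod K U" for K
    using that unfolding Michael_ultrafilter_def by blast
  obtain W B where W: "nonprincipal_ultrafilter W" "filter_basis W B" "cardinal_u = |B|"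
    using cardinal_u_basis[OF U] .
  then have small_B: "|B| <o cardinal_g" using assms by simp
  obtain f C where V: "nonprincipal_ultrafilter (filtermap f U)"
    and C: "filter_basis (filtermap f U) C" "|C| \<le>o |B|"
    using finite_to_one_image_small_character[OF U W(1,2) small_B] .
  have small: "|C| <o cardinal_g" using C(2) small_B by (rule ordLeq_ordLess_trans)
  obtain h where h: "\<forall>b\<in>C. \<not> le_mod (filtermap f U) h (next_in b)"
    using fewer_than_g_not_cofinal[OF V small] ..
  let ?K = "range (truncated_next h)" and ?pull = "\<lambda>g :: nat \<Rightarrow> nat. g \<circ> f"
  have "continuous_on UNIV ?pull"
    by (rule continuous_on_coordinatewise_then_product) (simp add: comp_def)
  then have compact: "compact (?pull ` ?K)"
    by (intro compact_continuous_image compact_truncated_next) (rule continuous_on_subset, auto)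
  have "natLeq <o cof_mod (?pull ` ?K) U"
  proof (rule uncountable_cof_mod)
    fix D assume D: "cofinal_mod U (?pull ` ?K) D"
    show "\<not> countable D"
    proof
      assume "countable D"
      then obtain D' where D': "countable D'" "D' \<subseteq> ?K" "D = ?pull ` D'"
        using D countable_subset_image[of D ?pull ?K] unfolding cofinal_mod_def by blast
      then have "cofinal_mod (filtermap f U) ?K D'" using D cofinal_mod_filtermap by blast
      from uncountable_cofinal_truncated_next[OF V C(1) small h this] show False
        using D'(1) by blast
    qed
  qed
  from Michael[OF compact this] have "cof_mod UNIV U \<le>o cof_mod (?pull ` ?K) U" .
  moreover have "cof_mod (?pull ` ?K) U \<le>o |?pull ` truncated_next h ` C|"
  proof (intro cof_mod_le)
    have "cofinal_mod (filtermap f U) ?K (truncated_next h ` C)"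
      by (rule cofinal_truncated_next_basis[OF V C(1)])
    then show "cofinal_mod U (?pull ` ?K) (?pull ` truncated_next h ` C)"
      by (subst cofinal_mod_filtermap) auto
  qed
  moreover have "|?pull ` truncated_next h ` C| \<le>o |C|"
    unfolding image_image by (rule card_of_image)
  ultimately have le: "cof_mod UNIV U \<le>o |C|" by (meson ordLeq_transitive)
  obtain D where D: "cofinal_mod U UNIV D" "cof_mod UNIV U = |D|"
    using cof_mod_attained by blast
  have "|D| <o cardinal_g" using le D(2) small ordLeq_ordLess_trans by metis
  then obtain k where "\<forall>g\<in>D. \<not> le_mod U k g"
    using fewer_than_g_not_cofinal[OF U, of D "\<lambda>g. g"] by blast
  then show False using D(1) unfolding cofinal_mod_def by blast
qed

end
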